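(* Let $\mathbb G=\mathbb G^{[3]}$ and $\alpha,\beta\in\mathbb Z_{\ge0}$. There is a canonical one-to-one correspondence between the set of double cosets $K(\alpha)\backslash\mathbb G/K(\beta)$ and the set of all $(\alpha,\beta)$-boards: to a double coset one assigns the $(\alpha,\beta)$-board obtained from the checker-board of any representative $\mathbf g\in\mathbb G$ by removing the numbers $>\beta$ from black triangles and the numbers $>\alpha$ from white triangles and then deleting all empty chebureks.
   Context: Group. $S_\infty$ is the group of all permutations of $\mathbb N=\{1,2,\dots\}$; $S_\infty(\alpha)$ is the pointwise stabilizer of $1,\dots,\alpha$ ($S_\infty(0)=S_\infty$); $S_\infty^{fin}$ is the subgroup of finitely supported permutations. $\mathbb G=\mathbb G^{[3]}$ is the group of triples $(g_{red},g_{yellow},g_{blue})\in S_\infty^3$ such that $g_ig_j^{-1}\in S_\infty^{fin}$ for all $i,j$. $K\subset\mathbb G$ is the diagonal copy of $S_\infty$ and $K(\alpha)\subset K$ the diagonal copy of $S_\infty(\alpha)$. Checker-board of an element. For $\mathbf g\in\mathbb G$ take disjoint oriented black triangles $A_i$ with sides colored red, yellow, blue anticlockwise, and oriented white triangles $B_i$ with sides colored red, yellow, blue clockwise, $i\in\mathbb N$. For each color $c$ and each $i$, glue the $c$-edge of $A_i$ to the $c$-edge of $B_{g_c(i)}$. The result is a countable disjoint union of compact closed oriented triangulated surfaces, all but finitely many of which are chebureks. The number $i$ is written on $A_i$ and on $B_i$. Chebureks. A cheburek is a component consisting of one black and one white triangle glued along all three edges of the same colors; it is empty if neither triangle carries a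 label. Boards. An $(\alpha,\beta)$-board is a compact closed oriented (generally disconnected, possibly empty) triangulated surface equipped with the following data: triangles are colored black and white, neighbors of black triangles being white and vice versa; edges are colored red, yellow, blue so that the boundary of any black (respectively white) triangle consists of a red, a yellow and a blue edge situated anticlockwise (respectively clockwise); labels $1,\dots,\beta$ are assigned to some (distinct) black triangles and labels $1,\dots,\alpha$ to some (distinct) white triangles; there are no empty chebureks. Boards are considered up to isomorphisms preserving all the data. (Equivalently: finite sets of black and of white triangles, for each of the three colors a bijection from the black to the white triangles, plus labels.) *)

theory Defs
  imports "HOL-Algebra.Algebra"
begin

section \<open>The group and its subgroups\<close>

datatype color = Red | Yellow | Blue

text \<open>The set of positive integers is \<^term>\<open>{1..} :: nat set\<close>. A permutation of it is a function on
  \<^typ>\<open>nat\<close> that fixes \<open>0\<close>, as in the library's \<^term>\<open>sym_group\<close>.\<close>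

definition Sinf :: "(nat \<Rightarrow> nat) monoid" where
  "Sinf = \<lparr>carrier = {p. p permutes {1..}}, monoid.mult = (\<circ>), one = id\<rparr>"

definition Sinf_fin :: "(nat \<Rightarrow> nat) set" where
  "Sinf_fin = {p \<in> carrier Sinf. finite {i \<in> {1..}. p i \<noteq> i}}"

definition Sinf_stab :: "nat \<Rightarrow> (nat \<Rightarrow> nat) set" where
  "Sinf_stab \<alpha> = {p \<in> carrier Sinf. \<forall>i\<in>{1..\<alpha>}. p i = i}"

definition GG :: "(color \<Rightarrow> nat \<Rightarrow> nat) monoid" where
  "GG = (product_group UNIV (\<lambda>_::color. Sinf))
     \<lparr>carrier := {g. (\<forall>c. g c \<in> carrier Sinf) \<and>
                     (\<forall>c d. g c \<otimes>\<^bsub>Sinf\<^esub> inv\<^bsub>Sinf\<^esub> (g d) \<in> Sinf_fin)}\<rparr>"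

definition K :: "nat \<Rightarrow> (color \<Rightarrow> nat \<Rightarrow> nat) set" where
  "K \<alpha> = {\<lambda>_. p |p. p \<in> Sinf_stab \<alpha>}"

definition double_coset :: "('a, 'b) monoid_scheme \<Rightarrow> 'a set \<Rightarrow> 'a \<Rightarrow> 'a set \<Rightarrow> 'a set" where
  "double_coset G H g L = (H #>\<^bsub>G\<^esub> g) <#>\<^bsub>G\<^esub> L"

definition double_cosets :: "('a, 'b) monoid_scheme \<Rightarrow> 'a set \<Rightarrow> 'a set \<Rightarrow> 'a set set" where
  "double_cosets G H L = {double_coset G H g L |g. g \<in> carrier G}"

lemma group_Sinf: "group Sinf"
proof (rule groupI)
  fix p assume "p \<in> carrier Sinf"
  then show "\<exists>q\<in>carrier Sinf. q \<otimes>\<^bsub>Sinf\<^esub> p = \<one>\<^bsub>Sinf\<^esub>"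
    by (auto simp: Sinf_def intro!: exI[of _ "inv_into UNIV p"] permutes_inv permutes_inv_o)
qed (auto simp: Sinf_def permutes_compose permutes_id)

lemma inv_Sinf: "p \<in> carrier Sinf \<Longrightarrow> inv\<^bsub>Sinf\<^esub> p = inv_into UNIV p"
  by (rule group.inv_equality[OF group_Sinf])
     (auto simp: Sinf_def permutes_inv permutes_inv_o)

lemma subgroup_Sinf_fin: "subgroup Sinf_fin Sinf"
proof -
  interpret group Sinf by (rule group_Sinf)
  show ?thesis
  proof (rule subgroupI)
    show "Sinf_fin \<subseteq> carrier Sinf" by (auto simp: Sinf_fin_def)
    have "id \<in> Sinf_fin" by (simp add: Sinf_fin_def Sinf_def permutes_id)
    then show "Sinf_fin \<noteq> {}" by blast
  next
    fix p assume p: "p \<in> Sinf_fin"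
    then have P: "p permutes {1..}" by (simp add: Sinf_fin_def Sinf_def)
    have "{i \<in> {1..}. inv_into UNIV p i \<noteq> i} \<subseteq> {i \<in> {1..}. p i \<noteq> i}"
      using permutes_inv_eq[OF P] by force
    with p show "inv\<^bsub>Sinf\<^esub> p \<in> Sinf_fin"
      by (auto simp: Sinf_fin_def inv_Sinf intro: finite_subset)
         (auto simp: Sinf_def permutes_inv)
  next
    fix p q assume "p \<in> Sinf_fin" "q \<in> Sinf_fin"
    moreover have "{i \<in> {1..}. (p \<circ> q) i \<noteq> i} \<subseteq> {i \<in> {1..}. p i \<noteq> i} \<union> {i \<in> {1..}. q i \<noteq> i}"
      by auto
    ultimately show "p \<otimes>\<^bsub>Sinf\<^esub> q \<in> Sinf_fin"
      by (auto simp: Sinf_fin_def Sinf_def permutes_compose intro: finite_subset)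
  qed
qed

lemma finite_support_conj:
  assumes p: "p \<in> Sinf_fin" and q: "q \<in> carrier Sinf"
  shows "inv\<^bsub>Sinf\<^esub> q \<otimes>\<^bsub>Sinf\<^esub> p \<otimes>\<^bsub>Sinf\<^esub> q \<in> Sinf_fin"
proof -
  interpret group Sinf by (rule group_Sinf)
  have Q: "q permutes {1..}" using q by (simp add: Sinf_def)
  have "{i \<in> {1..}. (inv_into UNIV q \<circ> p \<circ> q) i \<noteq> i} \<subseteq> q -` {i \<in> {1..}. p i \<noteq> i}"
    using permutes_in_image[OF Q] permutes_inverses[OF Q] by auto
  moreover have "finite (q -` {i \<in> {1..}. p i \<noteq> i})"
    using p permutes_inj[OF Q] by (intro finite_vimageI) (auto simp: Sinf_fin_def)
  ultimately have "finite {i \<in> {1..}. (inv_into UNIV q \<circ> p \<circ> q) i \<noteq> i}"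
    by (rule finite_subset)
  moreover have "inv\<^bsub>Sinf\<^esub> q \<otimes>\<^bsub>Sinf\<^esub> p \<otimes>\<^bsub>Sinf\<^esub> q \<in> carrier Sinf"
    using p q by (auto simp: Sinf_fin_def)
  ultimately show ?thesis
    using inv_Sinf[OF q] by (simp add: Sinf_fin_def) (simp add: Sinf_def)
qed

lemma group_GG: "group GG"
proof -
  interpret S: group Sinf by (rule group_Sinf)
  interpret P: group "product_group UNIV (\<lambda>_::color. Sinf)"
    by (rule product_group) (rule group_Sinf)
  interpret F: subgroup Sinf_fin Sinf by (rule subgroup_Sinf_fin)
  let ?H = "{g. (\<forall>c. g c \<in> carrier Sinf) \<and>
     (\<forall>c d. g c \<otimes>\<^bsub>Sinf\<^esub> inv\<^bsub>Sinf\<^esub> (g d) \<in> Sinf_fin)} :: (color \<Rightarrow> nat \<Rightarrow> nat) set"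
  have "subgroup ?H (product_group UNIV (\<lambda>_::color. Sinf))"
  proof (rule P.subgroupI)
    show "?H \<subseteq> carrier (product_group UNIV (\<lambda>_::color. Sinf))" by (auto simp: PiE_def)
    have "(\<lambda>_. \<one>\<^bsub>Sinf\<^esub>) \<in> ?H" by (simp add: F.one_closed)
    show "?H \<noteq> {}"
    proof
      assume "?H = {}"
      with \<open>(\<lambda>_. \<one>\<^bsub>Sinf\<^esub>) \<in> ?H\<close> show False by (simp only: empty_iff)
    qed
  next
    fix g assume g: "g \<in> ?H"
    have i: "inv\<^bsub>product_group UNIV (\<lambda>_::color. Sinf)\<^esub> g = (\<lambda>c. inv\<^bsub>Sinf\<^esub> (g c))"
      using g by (subst inv_product_group) (auto simp: PiE_def group_Sinf)
    have "inv\<^bsub>Sinf\<^esub> (g c) \<otimes>\<^bsub>Sinf\<^esub> inv\<^bsub>Sinf\<^esub> (inv\<^bsub>Sinf\<^esub> (g d)) \<in> Sinf_fin" for c d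
    proof -
      have c: "g c \<in> carrier Sinf" and d: "g d \<in> carrier Sinf"
        and "g d \<otimes>\<^bsub>Sinf\<^esub> inv\<^bsub>Sinf\<^esub> (g c) \<in> Sinf_fin" using g by auto
      from finite_support_conj[OF this(3) c] c d show ?thesis by (simp add: S.m_assoc)
    qed
    with g show "inv\<^bsub>product_group UNIV (\<lambda>_::color. Sinf)\<^esub> g \<in> ?H" unfolding i by auto
  next
    fix g h assume g: "g \<in> ?H" and h: "h \<in> ?H"
    have "(g c \<otimes>\<^bsub>Sinf\<^esub> h c) \<otimes>\<^bsub>Sinf\<^esub> inv\<^bsub>Sinf\<^esub> (g d \<otimes>\<^bsub>Sinf\<^esub> h d) \<in> Sinf_fin" for c d
    proof -
      have cl: "g c \<in> carrier Sinf" "g d \<in> carrier Sinf" "h c \<in> carrier Sinf" "h d \<in> carrier Sinf"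
        and f: "h c \<otimes>\<^bsub>Sinf\<^esub> inv\<^bsub>Sinf\<^esub> (h d) \<in> Sinf_fin" "g c \<otimes>\<^bsub>Sinf\<^esub> inv\<^bsub>Sinf\<^esub> (g d) \<in> Sinf_fin"
        using g h by auto
      have "g c \<otimes>\<^bsub>Sinf\<^esub> (h c \<otimes>\<^bsub>Sinf\<^esub> inv\<^bsub>Sinf\<^esub> (h d)) \<otimes>\<^bsub>Sinf\<^esub> inv\<^bsub>Sinf\<^esub> (g c) \<in> Sinf_fin"
        using finite_support_conj[OF f(1), of "inv\<^bsub>Sinf\<^esub> (g c)"] cl by simp
      note F.m_closed[OF this f(2)]
      moreover have "inv\<^bsub>Sinf\<^esub> (g c) \<otimes>\<^bsub>Sinf\<^esub> (g c \<otimes>\<^bsub>Sinf\<^esub> x) = x" if "x \<in> carrier Sinf" for x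
        using cl that by (simp flip: S.m_assoc)
      ultimately show ?thesis
        using cl by (simp add: S.m_assoc S.inv_mult_group)
    qed
    with g h show "g \<otimes>\<^bsub>product_group UNIV (\<lambda>_::color. Sinf)\<^esub> h \<in> ?H"
      by (auto simp: product_group_def)
  qed
  from P.subgroup_imp_group[OF this] show ?thesis by (simp add: GG_def)
qed

lemma subgroup_K: "subgroup (K \<alpha>) GG"
proof -
  interpret S: group Sinf by (rule group_Sinf)
  interpret F: subgroup Sinf_fin Sinf by (rule subgroup_Sinf_fin)
  interpret G: group GG by (rule group_GG)
  have mult: "g \<otimes>\<^bsub>GG\<^esub> h = (\<lambda>c. g c \<circ> h c)" for g h
    by (auto simp: GG_def product_group_def Sinf_def)
  have one: "\<one>\<^bsub>GG\<^esub> = (\<lambda>c. id)" by (auto simp: GG_def product_group_def Sinf_def)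
  have sub: "K \<alpha> \<subseteq> carrier GG"
    using F.one_closed by (auto simp: K_def GG_def Sinf_stab_def)
  show ?thesis
  proof (rule G.subgroupI)
    show "K \<alpha> \<subseteq> carrier GG" by (rule sub)
    have "id \<in> Sinf_stab \<alpha>" by (simp add: Sinf_stab_def Sinf_def permutes_id)
    then show "K \<alpha> \<noteq> {}" by (auto simp: K_def)
  next
    fix a assume a: "a \<in> K \<alpha>"
    then obtain p where p: "p \<in> Sinf_stab \<alpha>" "a = (\<lambda>_. p)" by (auto simp: K_def)
    then have P: "p permutes {1..}" by (simp add: Sinf_stab_def Sinf_def)
    have q: "inv_into UNIV p \<in> Sinf_stab \<alpha>"
      using p(1) P permutes_inv_eq[OF P] by (auto simp: Sinf_stab_def Sinf_def permutes_inv)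
    then have k: "(\<lambda>_. inv_into UNIV p) \<in> K \<alpha>" by (auto simp: K_def)
    have "inv\<^bsub>GG\<^esub> a = (\<lambda>_. inv_into UNIV p)"
      using a k sub permutes_inv_o[OF P] p(2)
      by (intro G.inv_equality) (auto simp: mult one)
    with k show "inv\<^bsub>GG\<^esub> a \<in> K \<alpha>" by simp
  next
    fix a b assume "a \<in> K \<alpha>" "b \<in> K \<alpha>"
    then obtain p q where "p \<in> Sinf_stab \<alpha>" "a = (\<lambda>_. p)" "q \<in> Sinf_stab \<alpha>" "b = (\<lambda>_. q)"
      by (auto simp: K_def)
    moreover from this have "p \<circ> q \<in> Sinf_stab \<alpha>"
      by (auto simp: Sinf_stab_def Sinf_def permutes_compose)
    ultimately show "a \<otimes>\<^bsub>GG\<^esub> b \<in> K \<alpha>" by (auto simp: mult K_def)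
  qed
qed


section \<open>Checker-boards\<close>

text \<open>A triangulated surface with checker-board and edge colorings is encoded by its gluing data:
  sets of black and of white triangles and, for each color \<open>c\<close>, the map sending a black
  triangle to the white triangle that shares its \<open>c\<close>-edge. Since every triangle has exactly one
  edge of each color, the surface has no boundary iff these maps are bijections. Opposite cyclic
  orders of the colors on black and white triangles orient the glued surface, so the orientation
  carries no further data. The labels are partial maps from triangles to numbers.\<close>

record ('b, 'w) surface =
  black :: "'b set"
  white :: "'w set"
  glue :: "color \<Rightarrow> 'b \<Rightarrow> 'w"
  black_label :: "'b \<rightharpoonup> nat"
  white_label :: "'w \<rightharpoonup> nat"

definition colored_surface :: "('b, 'w) surface \<Rightarrow> bool" where
  "colored_surface S \<longleftrightarrow> (\<forall>c. bij_betw (glue S c) (black S) (white S))"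

definition cheburek :: "('b, 'w) surface \<Rightarrow> 'b \<Rightarrow> 'w \<Rightarrow> bool" where
  "cheburek S b w \<longleftrightarrow> b \<in> black S \<and> w \<in> white S \<and> (\<forall>c. glue S c b = w)"

definition empty_cheburek :: "('b, 'w) surface \<Rightarrow> 'b \<Rightarrow> 'w \<Rightarrow> bool" where
  "empty_cheburek S b w \<longleftrightarrow> cheburek S b w \<and> black_label S b = None \<and> white_label S w = None"

definition labels_assigned :: "nat \<Rightarrow> ('t \<rightharpoonup> nat) \<Rightarrow> 't set \<Rightarrow> bool" where
  "labels_assigned n L T \<longleftrightarrow> dom L \<subseteq> T \<and> inj_on L (dom L) \<and> ran L = {1..n}"

text \<open>Compactness is finiteness of the triangulation.\<close>

definition board :: "nat \<Rightarrow> nat \<Rightarrow> ('b, 'w) surface \<Rightarrow> bool" where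
  "board \<alpha> \<beta> S \<longleftrightarrow>
     finite (black S) \<and> finite (white S) \<and> colored_surface S \<and>
     labels_assigned \<beta> (black_label S) (black S) \<and>
     labels_assigned \<alpha> (white_label S) (white S) \<and>
     (\<nexists>b w. empty_cheburek S b w)"

definition surface_iso :: "('b, 'w) surface \<Rightarrow> ('c, 'v) surface \<Rightarrow> bool" where
  "surface_iso S T \<longleftrightarrow> (\<exists>\<phi> \<psi>.
     bij_betw \<phi> (black S) (black T) \<and> bij_betw \<psi> (white S) (white T) \<and>
     (\<forall>c. \<forall>b\<in>black S. \<psi> (glue S c b) = glue T c (\<phi> b)) \<and>
     (\<forall>b\<in>black S. black_label T (\<phi> b) = black_label S b) \<and>
     (\<forall>w\<in>white S. white_label T (\<psi> w) = white_label S w))"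

text \<open>To have a set of all boards up to isomorphism, the triangles are taken from \<^typ>\<open>nat\<close>; lemma
  \<open>board_iso_nat\<close> below shows that no board is lost.\<close>

definition board_iso_rel :: "nat \<Rightarrow> nat \<Rightarrow> (nat, nat) surface rel" where
  "board_iso_rel \<alpha> \<beta> = {(S, T). board \<alpha> \<beta> S \<and> board \<alpha> \<beta> T \<and> surface_iso S T}"

definition boards :: "nat \<Rightarrow> nat \<Rightarrow> (nat, nat) surface set set" where
  "boards \<alpha> \<beta> = {S. board \<alpha> \<beta> S} // board_iso_rel \<alpha> \<beta>"

lemma surface_iso_refl: "surface_iso S S"
  unfolding surface_iso_def by (intro exI[of _ id]) auto

lemma surface_iso_sym:
  assumes "surface_iso S T" "colored_surface S"
  shows "surface_iso T S"
proof -
  obtain \<phi> \<psi> where b: "bij_betw \<phi> (black S) (black T)" and w: "bij_betw \<psi> (white S) (white T)"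
    and g: "\<And>c b. b \<in> black S \<Longrightarrow> \<psi> (glue S c b) = glue T c (\<phi> b)"
    and lb: "\<And>b. b \<in> black S \<Longrightarrow> black_label T (\<phi> b) = black_label S b"
    and lw: "\<And>w. w \<in> white S \<Longrightarrow> white_label T (\<psi> w) = white_label S w"
    using assms(1) unfolding surface_iso_def by blast
  let ?\<phi> = "inv_into (black S) \<phi>" and ?\<psi> = "inv_into (white S) \<psi>"
  note [simp] = bij_betw_inv_into_left[OF b] bij_betw_inv_into_left[OF w]
    bij_betw_inv_into_right[OF b] bij_betw_inv_into_right[OF w]
  have ib: "?\<phi> x \<in> black S" if "x \<in> black T" for x
    using bij_betwE[OF bij_betw_inv_into[OF b]] that by blast
  have iw: "?\<psi> x \<in> white S" if "x \<in> white T" for x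
    using bij_betwE[OF bij_betw_inv_into[OF w]] that by blast
  have gl: "?\<psi> (glue T c x) = glue S c (?\<phi> x)" if x: "x \<in> black T" for c x
  proof -
    have "glue S c (?\<phi> x) \<in> white S"
      using assms(2) ib[OF x] unfolding colored_surface_def by (meson bij_betwE)
    with g[OF ib[OF x], of c] x show ?thesis by (metis bij_betw_inv_into_left[OF w] bij_betw_inv_into_right[OF b])
  qed
  have "black_label S (?\<phi> x) = black_label T x" if "x \<in> black T" for x
    using lb[OF ib[OF that]] that by simp
  moreover have "white_label S (?\<psi> x) = white_label T x" if "x \<in> white T" for x
    using lw[OF iw[OF that]] that by simp
  ultimately show ?thesis
    unfolding surface_iso_def using gl bij_betw_inv_into[OF b] bij_betw_inv_into[OF w] by blast
qed

lemma surface_iso_trans: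
  assumes "surface_iso S T" "surface_iso T U"
  shows "surface_iso S U"
proof -
  obtain \<phi> \<psi> where 1: "bij_betw \<phi> (black S) (black T)" "bij_betw \<psi> (white S) (white T)"
    "\<forall>c. \<forall>b\<in>black S. \<psi> (glue S c b) = glue T c (\<phi> b)"
    "\<forall>b\<in>black S. black_label T (\<phi> b) = black_label S b"
    "\<forall>w\<in>white S. white_label T (\<psi> w) = white_label S w"
    using assms(1) unfolding surface_iso_def by blast
  obtain \<phi>' \<psi>' where 2: "bij_betw \<phi>' (black T) (black U)" "bij_betw \<psi>' (white T) (white U)"
    "\<forall>c. \<forall>b\<in>black T. \<psi>' (glue T c b) = glue U c (\<phi>' b)"
    "\<forall>b\<in>black T. black_label U (\<phi>' b) = black_label T b"
    "\<forall>w\<in>white T. white_label U (\<psi>' w) = white_label T w"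
    using assms(2) unfolding surface_iso_def by blast
  show ?thesis
    unfolding surface_iso_def
    using 1 2 bij_betwE[OF 1(1)] bij_betwE[OF 1(2)]
    by (intro exI[of _ "\<phi>' \<circ> \<phi>"] exI[of _ "\<psi>' \<circ> \<psi>"]) (auto intro: bij_betw_trans)
qed

lemma equiv_board_iso_rel: "equiv {S. board \<alpha> \<beta> S} (board_iso_rel \<alpha> \<beta>)"
  by (rule equivI)
     (auto simp: board_iso_rel_def refl_on_def sym_def trans_def board_def
           intro: surface_iso_refl surface_iso_sym surface_iso_trans)

lemma board_iso_nat:
  fixes S :: "('b, 'w) surface"
  assumes S: "board \<alpha> \<beta> S"
  shows "\<exists>T :: (nat, nat) surface. board \<alpha> \<beta> T \<and> surface_iso S T"
proof -
  let ?B = "{0..<card (black S)}" and ?W = "{0..<card (white S)}"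
  obtain \<phi> where \<phi>: "bij_betw \<phi> ?B (black S)"
    using S ex_bij_betw_nat_finite by (metis board_def)
  obtain \<psi> where \<psi>: "bij_betw \<psi> ?W (white S)"
    using S ex_bij_betw_nat_finite by (metis board_def)
  define \<psi>' where "\<psi>' = inv_into ?W \<psi>"
  have \<psi>': "bij_betw \<psi>' (white S) ?W" unfolding \<psi>'_def by (rule bij_betw_inv_into[OF \<psi>])
  have r: "\<psi> (\<psi>' w) = w" if "w \<in> white S" for w
    unfolding \<psi>'_def by (rule bij_betw_inv_into_right[OF \<psi> that])
  have l: "\<psi>' (\<psi> w) = w" if "w \<in> ?W" for w
    unfolding \<psi>'_def by (rule bij_betw_inv_into_left[OF \<psi> that])
  define T :: "(nat, nat) surface" where
    "T = \<lparr>black = ?B, white = ?W, glue = (\<lambda>c b. \<psi>' (glue S c (\<phi> b))),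
          black_label = (\<lambda>b. if b \<in> ?B then black_label S (\<phi> b) else None),
          white_label = (\<lambda>w. if w \<in> ?W then white_label S (\<psi> w) else None)\<rparr>"
  have gw: "glue S c (\<phi> b) \<in> white S" if "b \<in> ?B" for c b
    using S that bij_betwE[OF \<phi>] unfolding board_def colored_surface_def by (meson bij_betwE)
  have cs: "colored_surface T"
    unfolding colored_surface_def
  proof
    fix c
    have "bij_betw (glue S c) (black S) (white S)"
      using S unfolding board_def colored_surface_def by blast
    from bij_betw_trans[OF \<phi> bij_betw_trans[OF this \<psi>']]
    show "bij_betw (glue T c) (black T) (white T)" by (simp add: T_def comp_def)
  qed
  have labels: "labels_assigned n (\<lambda>t. if t \<in> A then L (f t) else None) A"
    if L: "labels_assigned n L B" and f: "bij_betw f A B" for n L A B and f :: "nat \<Rightarrow> 't"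
  proof -
    let ?L = "\<lambda>t. if t \<in> A then L (f t) else None"
    have "dom ?L \<subseteq> A" by (auto split: if_splits)
    moreover have "inj_on ?L (dom ?L)"
    proof (rule inj_onI)
      fix x y assume "x \<in> dom ?L" "y \<in> dom ?L" "?L x = ?L y"
      then have "x \<in> A" "y \<in> A" "L (f x) = L (f y)" "f x \<in> dom L" "f y \<in> dom L"
        by (auto split: if_splits)
      then have "f x = f y" using L unfolding labels_assigned_def by (meson inj_onD)
      with \<open>x \<in> A\<close> \<open>y \<in> A\<close> f show "x = y" by (meson bij_betw_imp_inj_on inj_onD)
    qed
    moreover have "ran ?L = ran L"
    proof
      show "ran ?L \<subseteq> ran L" by (auto simp: ran_def split: if_splits)
      show "ran L \<subseteq> ran ?L"
      proof
        fix k assume "k \<in> ran L"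
        then obtain t where t: "L t = Some k" by (auto simp: ran_def)
        then have "t \<in> B" using L unfolding labels_assigned_def by blast
        then obtain s where "s \<in> A" "t = f s" using f unfolding bij_betw_def by blast
        with t have "?L s = Some k" by simp
        then show "k \<in> ran ?L" by (rule ranI)
      qed
    qed
    ultimately show ?thesis using L by (simp add: labels_assigned_def)
  qed
  have "\<not> empty_cheburek T b w" for b w
  proof
    assume e: "empty_cheburek T b w"
    then have b: "b \<in> ?B" and w: "w \<in> ?W" and c: "\<And>c. \<psi>' (glue S c (\<phi> b)) = w"
      by (auto simp: empty_cheburek_def cheburek_def T_def)
    then have "glue S c (\<phi> b) = \<psi> w" for c using r[OF gw[OF b]] by metis
    with e b w have "empty_cheburek S (\<phi> b) (\<psi> w)"
      using bij_betwE[OF \<phi>] bij_betwE[OF \<psi>] by (auto simp: empty_cheburek_def cheburek_def T_def)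
    with S show False by (auto simp: board_def)
  qed
  with S cs labels[OF _ \<phi>] labels[OF _ \<psi>] have T: "board \<alpha> \<beta> T"
    unfolding board_def by (auto simp: T_def)
  have "surface_iso T S"
    unfolding surface_iso_def
    by (rule exI[of _ \<phi>], rule exI[of _ \<psi>]) (use \<phi> \<psi> r gw in \<open>auto simp: T_def\<close>)
  from surface_iso_sym[OF this cs] T show ?thesis by blast
qed


section \<open>The board of a group element\<close>

definition checker_board :: "(color \<Rightarrow> nat \<Rightarrow> nat) \<Rightarrow> (nat, nat) surface" where
  "checker_board g =
     \<lparr>black = {1..}, white = {1..}, glue = g,
      black_label = (\<lambda>i. if i \<in> {1..} then Some i else None),
      white_label = (\<lambda>i. if i \<in> {1..} then Some i else None)\<rparr>"

definition truncate_label :: "nat \<Rightarrow> ('t \<rightharpoonup> nat) \<Rightarrow> 't \<rightharpoonup> nat" where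
  "truncate_label n L = (\<lambda>t. case L t of None \<Rightarrow> None | Some k \<Rightarrow> if k \<le> n then Some k else None)"

definition remove_numbers :: "nat \<Rightarrow> nat \<Rightarrow> ('b, 'w) surface \<Rightarrow> ('b, 'w) surface" where
  "remove_numbers \<alpha> \<beta> S =
     S\<lparr>black_label := truncate_label \<beta> (black_label S),
       white_label := truncate_label \<alpha> (white_label S)\<rparr>"

definition delete_empty_chebureks :: "('b, 'w) surface \<Rightarrow> ('b, 'w) surface" where
  "delete_empty_chebureks S =
     S\<lparr>black := {b \<in> black S. \<nexists>w. empty_cheburek S b w},
       white := {w \<in> white S. \<nexists>b. empty_cheburek S b w}\<rparr>"

definition board_of :: "nat \<Rightarrow> nat \<Rightarrow> (color \<Rightarrow> nat \<Rightarrow> nat) \<Rightarrow> (nat, nat) surface" where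
  "board_of \<alpha> \<beta> g = delete_empty_chebureks (remove_numbers \<alpha> \<beta> (checker_board g))"

end

theory Submission
  imports Defs
begin

text \<open>An isomorphism between the boards of \<open>g\<close> and \<open>h\<close> matches all but the deleted empty chebureks.
  Infinitely many of these are deleted on either side, so any bijection between them extends it to an
  isomorphism of the whole checker-boards, i.e. to permutations \<open>p\<close>, \<open>q\<close> with
  \<open>h\<^sub>c = p g\<^sub>c q\<close>; preservation of the labels says that \<open>p \<in> S\<^sub>\<infinity>(\<alpha>)\<close> and \<open>q \<in> S\<^sub>\<infinity>(\<beta>)\<close>.
  Conversely, numbering the triangles of a board compatibly with its labels and adding infinitely
  many empty chebureks gives the checker-board of an element of the group.\<close>

section \<open>Double cosets in an abstract group\<close>

lemma (in group) mem_double_coset_iff: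
  "x \<in> double_coset G H g L \<longleftrightarrow> (\<exists>a\<in>H. \<exists>b\<in>L. x = a \<otimes> g \<otimes> b)"
  by (auto simp: double_coset_def r_coset_def set_mult_def)

text \<open>If \<open>h\<close> is \<open>a\<close> times \<open>g\<close> times \<open>b\<close>,
  the subgroups absorb the factors \<open>a\<close> and \<open>b\<close>, which gives one inclusion.
  Solving for \<open>g\<close> gives a relation of the same shape with the inverse factors, hence
  the other inclusion.\<close>

lemma (in group) double_coset_eqI:
  assumes H: "subgroup H G" and L: "subgroup L G" and g: "g \<in> carrier G"
    and h: "h \<in> double_coset G H g L"
  shows "double_coset G H h L = double_coset G H g L"
proof -
  have sub: "double_coset G H y L \<subseteq> double_coset G H x L"
    if x: "x \<in> carrier G" and y: "y \<in> double_coset G H x L" for x y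
  proof
    fix z assume z: "z \<in> double_coset G H y L"
    obtain a b where ab: "a \<in> H" "b \<in> L" "y = a \<otimes> x \<otimes> b"
      using y by (auto simp: mem_double_coset_iff)
    obtain a' b' where ab': "a' \<in> H" "b' \<in> L" "z = a' \<otimes> y \<otimes> b'"
      using z by (auto simp: mem_double_coset_iff)
    have "z = (a' \<otimes> a) \<otimes> x \<otimes> (b \<otimes> b')"
      using ab ab' x subgroup.mem_carrier[OF H] subgroup.mem_carrier[OF L] by (simp add: m_assoc)
    then show "z \<in> double_coset G H x L"
      using ab ab' subgroup.m_closed[OF H] subgroup.m_closed[OF L]
      unfolding mem_double_coset_iff by blast
  qed
  obtain a b where ab: "a \<in> H" "b \<in> L" "h = a \<otimes> g \<otimes> b"
    using h by (auto simp: mem_double_coset_iff)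
  then have c: "a \<in> carrier G" "b \<in> carrier G"
    using subgroup.mem_carrier[OF H] subgroup.mem_carrier[OF L] by auto
  have "g = inv a \<otimes> h \<otimes> inv b"
  proof -
    have "inv a \<otimes> h \<otimes> inv b = (inv a \<otimes> a) \<otimes> g \<otimes> (b \<otimes> inv b)"
      using c g by (simp only: ab(3) m_assoc m_closed inv_closed)
    then show ?thesis using c g by simp
  qed
  then have "g \<in> double_coset G H h L"
    using ab subgroup.m_inv_closed[OF H] subgroup.m_inv_closed[OF L]
    unfolding mem_double_coset_iff by blast
  moreover have "h \<in> carrier G" using ab c g by simp
  ultimately show ?thesis using sub g h by blast
qed

lemma (in group) mem_double_coset_self:
  assumes "subgroup H G" "subgroup L G" "g \<in> carrier G"
  shows "g \<in> double_coset G H g L"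
  using assms subgroup.one_closed[OF assms(1)] subgroup.one_closed[OF assms(2)]
  unfolding mem_double_coset_iff by (intro bexI[of _ \<one>]) auto

section \<open>Stabilizers and the group \<open>GG\<close> in terms of plain permutations\<close>

lemma mem_Sinf_stab_iff: "p \<in> Sinf_stab n \<longleftrightarrow> p permutes {1..} \<and> (\<forall>i\<in>{1..n}. p i = i)"
  by (simp add: Sinf_stab_def Sinf_def)

lemma inv_mem_Sinf_stab:
  assumes "p \<in> Sinf_stab n"
  shows "inv_into UNIV p \<in> Sinf_stab n"
  using assms by (auto simp: mem_Sinf_stab_iff permutes_inv permutes_inv_eq)

text \<open>Both \<open>p\<close> and its inverse fix every number up to \<open>n\<close>, including
  \<open>0\<close>, which lies outside \<open>{1..}\<close>. So no number crosses the bound in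
  either direction.\<close>

lemma Sinf_stab_le_iff:
  assumes p: "p \<in> Sinf_stab n"
  shows "p i \<le> n \<longleftrightarrow> i \<le> n"
proof -
  have fix0: "q j = j" if "q \<in> Sinf_stab n" "j \<le> n" for q j
    using that permutes_not_in[of q "{1..}" j] by (cases "j = 0") (auto simp: mem_Sinf_stab_iff)
  have "inv_into UNIV p (p i) = i"
    using p by (auto simp: mem_Sinf_stab_iff permutes_inverses)
  then show ?thesis
    using fix0[OF p] fix0[OF inv_mem_Sinf_stab[OF p]] by metis
qed

text \<open>The inverse of \<open>g d\<close> followed by \<open>g c\<close> moves exactly the
  images under \<open>g d\<close> of the points where \<open>g c\<close> and \<open>g d\<close>
  disagree, so its support is finite iff there are finitely many disagreements. The point
  \<open>0\<close> never counts, since both permutations fix it.\<close>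

lemma mem_carrier_GG_iff:
  "g \<in> carrier GG \<longleftrightarrow> (\<forall>c. g c permutes {1..}) \<and> (\<forall>c d. finite {i. g c i \<noteq> g d i})"
proof -
  have "g c \<otimes>\<^bsub>Sinf\<^esub> inv\<^bsub>Sinf\<^esub> (g d) \<in> Sinf_fin \<longleftrightarrow> finite {i. g c i \<noteq> g d i}"
    if c: "g c permutes {1..}" and d: "g d permutes {1..}" for c d
  proof -
    have "{i \<in> {1..}. (g c \<circ> inv_into UNIV (g d)) i \<noteq> i} = g d ` {i. g c i \<noteq> g d i}" (is "?L = ?R")
    proof
      show "?L \<subseteq> ?R"
      proof
        fix j assume "j \<in> ?L"
        then show "j \<in> ?R"
          using permutes_inverses[OF d] by (intro image_eqI[of _ _ "inv_into UNIV (g d) j"]) auto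
      qed
      show "?R \<subseteq> ?L"
      proof
        fix j assume "j \<in> ?R"
        then obtain i where i: "j = g d i" "g c i \<noteq> g d i" by auto
        then have "i \<in> {1..}"
          using permutes_not_in[OF c, of i] permutes_not_in[OF d, of i] by fastforce
        then show "j \<in> ?L" using i permutes_inverses[OF d] permutes_in_image[OF d] by auto
      qed
    qed
    then have "finite ?L \<longleftrightarrow> finite {i. g c i \<noteq> g d i}"
      using finite_image_iff[OF permutes_inj_on[OF d]] by simp
    moreover have "inv\<^bsub>Sinf\<^esub> (g d) = inv_into UNIV (g d)"
      using d by (intro inv_Sinf) (simp add: Sinf_def)
    ultimately show ?thesis
      using permutes_compose[OF permutes_inv[OF d] c] by (simp add: Sinf_fin_def) (simp add: Sinf_def)
  qed
  moreover have "g c \<in> carrier Sinf \<longleftrightarrow> g c permutes {1..}" for c by (simp add: Sinf_def)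
  ultimately show ?thesis by (auto simp: GG_def)
qed

text \<open>Elements of \<open>K\<close> do not depend on the color, so one \<open>p\<close> and one
  \<open>q\<close> serve all three colors. On checker-boards, \<open>p\<close> renumbers the white
  triangles and the inverse of \<open>q\<close> the black ones.\<close>

lemma mem_double_coset_GG_iff:
  "h \<in> double_coset GG (K \<alpha>) g (K \<beta>) \<longleftrightarrow>
     (\<exists>p\<in>Sinf_stab \<alpha>. \<exists>q\<in>Sinf_stab \<beta>. \<forall>c. h c = p \<circ> g c \<circ> q)"
proof -
  interpret G: group GG by (rule group_GG)
  have mult: "x \<otimes>\<^bsub>GG\<^esub> y = (\<lambda>c. x c \<circ> y c)" for x y
    by (auto simp: GG_def product_group_def Sinf_def)
  show ?thesis
    unfolding G.mem_double_coset_iff mult K_def fun_eq_iff[of h] by fast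
qed

section \<open>Empty chebureks, their deletion, and isomorphisms\<close>

lemma truncate_label_number:
  "truncate_label n (\<lambda>i. if i \<in> {1..} then Some i else None) = (\<lambda>i. if i \<in> {1..n} then Some i else None)"
  by (auto simp: truncate_label_def)

text \<open>The strict bounds express missing labels and also make \<open>b\<close> and
  \<open>w\<close> positive, which puts them among the triangles.\<close>

lemma empty_cheburek_remove_numbers_iff:
  "empty_cheburek (remove_numbers \<alpha> \<beta> (checker_board g)) b w \<longleftrightarrow>
     \<beta> < b \<and> \<alpha> < w \<and> (\<forall>c. g c b = w)"
  by (auto simp: empty_cheburek_def cheburek_def remove_numbers_def checker_board_def
      truncate_label_number[simplified] split: if_splits)

lemma board_of_simps:
  "black (board_of \<alpha> \<beta> g) = {b \<in> {1..}. \<nexists>w. \<beta> < b \<and> \<alpha> < w \<and> (\<forall>c. g c b = w)}"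
  "white (board_of \<alpha> \<beta> g) = {w \<in> {1..}. \<nexists>b. \<beta> < b \<and> \<alpha> < w \<and> (\<forall>c. g c b = w)}"
  "glue (board_of \<alpha> \<beta> g) = g"
  "black_label (board_of \<alpha> \<beta> g) = (\<lambda>i. if i \<in> {1..\<beta>} then Some i else None)"
  "white_label (board_of \<alpha> \<beta> g) = (\<lambda>i. if i \<in> {1..\<alpha>} then Some i else None)"
  unfolding board_of_def delete_empty_chebureks_def
  by (simp_all add: empty_cheburek_remove_numbers_iff)
     (auto simp: remove_numbers_def checker_board_def truncate_label_number[simplified])

text \<open>Each gluing map carries the black triangles of empty chebureks exactly onto the white
  ones, so it restricts to a bijection of the complements.\<close>

lemma colored_surface_delete_empty_chebureks:
  assumes S: "colored_surface S"
  shows "colored_surface (delete_empty_chebureks S)"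
  unfolding colored_surface_def
proof
  fix c
  let ?E = "{b \<in> black S. \<exists>w. empty_cheburek S b w}" and ?F = "{w \<in> white S. \<exists>b. empty_cheburek S b w}"
  have bij: "bij_betw (glue S c) (black S) (white S)"
    using S by (simp add: colored_surface_def)
  have "glue S c ` ?E = ?F"
  proof
    show "glue S c ` ?E \<subseteq> ?F" by (auto simp: empty_cheburek_def cheburek_def)
    show "?F \<subseteq> glue S c ` ?E"
    proof
      fix w assume "w \<in> ?F"
      then obtain b where b: "empty_cheburek S b w" by blast
      then have "glue S c b = w" "b \<in> ?E" by (auto simp: empty_cheburek_def cheburek_def)
      then show "w \<in> glue S c ` ?E" by blast
    qed
  qed
  then have "bij_betw (glue S c) (black S - ?E) (white S - ?F)"
    using bij by (auto simp: bij_betw_def inj_on_image_set_diff[of _ "black S"] intro: inj_on_subset)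
  moreover have "black S - ?E = black (delete_empty_chebureks S)"
    "white S - ?F = white (delete_empty_chebureks S)"
    by (auto simp: delete_empty_chebureks_def)
  ultimately show "bij_betw (glue (delete_empty_chebureks S) c)
      (black (delete_empty_chebureks S)) (white (delete_empty_chebureks S))"
    by (simp add: delete_empty_chebureks_def)
qed

text \<open>An isomorphism preserves and reflects empty chebureks, so the same two maps restrict to
  what is left. Reflection uses that \<open>\<psi>\<close> is injective on the white triangles,
  where all values of the gluing maps lie.\<close>

lemma surface_iso_delete_empty_chebureks:
  assumes "surface_iso S T" and S: "colored_surface S"
  shows "surface_iso (delete_empty_chebureks S) (delete_empty_chebureks T)"
proof -
  obtain \<phi> \<psi> where b: "bij_betw \<phi> (black S) (black T)" and w: "bij_betw \<psi> (white S) (white T)"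
    and g: "\<And>c b. b \<in> black S \<Longrightarrow> \<psi> (glue S c b) = glue T c (\<phi> b)"
    and lb: "\<And>b. b \<in> black S \<Longrightarrow> black_label T (\<phi> b) = black_label S b"
    and lw: "\<And>w. w \<in> white S \<Longrightarrow> white_label T (\<psi> w) = white_label S w"
    using assms(1) unfolding surface_iso_def by blast
  have iff: "empty_cheburek T (\<phi> x) (\<psi> y) \<longleftrightarrow> empty_cheburek S x y"
    if x: "x \<in> black S" and y: "y \<in> white S" for x y
  proof -
    have "glue S c x \<in> white S" for c
      using S x unfolding colored_surface_def by (meson bij_betwE)
    then have "glue T c (\<phi> x) = \<psi> y \<longleftrightarrow> glue S c x = y" for c
      using g[OF x, of c] y bij_betw_imp_inj_on[OF w] by (metis inj_onD)
    then show ?thesis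
      using x y bij_betwE[OF b] bij_betwE[OF w] lb[OF x] lw[OF y]
      by (auto simp: empty_cheburek_def cheburek_def)
  qed
  have mem: "empty_cheburek U x y \<Longrightarrow> x \<in> black U \<and> y \<in> white U"
    for U :: "('x, 'y) surface" and x y by (simp add: empty_cheburek_def cheburek_def)
  have eb: "(\<exists>y. empty_cheburek T (\<phi> x) y) \<longleftrightarrow> (\<exists>y. empty_cheburek S x y)" if x: "x \<in> black S" for x
    using iff[OF x] mem w by (metis bij_betw_iff_bijections)
  have ew: "(\<exists>x. empty_cheburek T x (\<psi> y)) \<longleftrightarrow> (\<exists>x. empty_cheburek S x y)" if y: "y \<in> white S" for y
    using iff[OF _ y] mem b by (metis bij_betw_iff_bijections)
  show ?thesis
    unfolding surface_iso_def
    using bij_betw_Collect[OF b, of "\<lambda>x. \<nexists>y. empty_cheburek T x y"]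
      bij_betw_Collect[OF w, of "\<lambda>y. \<nexists>x. empty_cheburek T x y"] eb ew g lb lw
    by (intro exI[of _ \<phi>] exI[of _ \<psi>]) (auto simp: delete_empty_chebureks_def)
qed

section \<open>From group elements to boards\<close>

text \<open>A black triangle survives only if its number is at most \<open>\<beta>\<close>, or some
  color disagrees with red there, or its red neighbor has number at most \<open>\<alpha>\<close>.
  Each condition holds at finitely many numbers.\<close>

lemma finite_black_board_of:
  assumes "g \<in> carrier GG"
  shows "finite (black (board_of \<alpha> \<beta> g))"
proof -
  have p: "inj (g c)" and f: "finite {i. g c i \<noteq> g Red i}" for c
    using assms by (auto simp: mem_carrier_GG_iff intro: permutes_inj)
  have "black (board_of \<alpha> \<beta> g) \<subseteq> {..\<beta>} \<union> (\<Union>c. {i. g c i \<noteq> g Red i}) \<union> g Red -` {..\<alpha>}"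
    by (auto simp: board_of_simps not_less)
  moreover have "finite (UNIV :: color set)"
    by (rule finite_subset[of _ "{Red, Yellow, Blue}"]) (auto intro: color.exhaust)
  ultimately show ?thesis
    using p f by (elim finite_subset) (auto intro: finite_vimageI)
qed

lemma colored_surface_remove_numbers:
  assumes "g \<in> carrier GG"
  shows "colored_surface (remove_numbers \<alpha> \<beta> (checker_board g))"
  using assms
  by (auto simp: colored_surface_def remove_numbers_def checker_board_def mem_carrier_GG_iff
      intro: permutes_imp_bij)

text \<open>Deletion changes neither gluing nor labels, so an empty cheburek of the result would
  have been one before and is already gone. Finiteness passes from black to white along a gluing
  bijection.\<close>

lemma board_board_of:
  assumes g: "g \<in> carrier GG"
  shows "board \<alpha> \<beta> (board_of \<alpha> \<beta> g)"
proof -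
  have labels: "labels_assigned n (\<lambda>i. if i \<in> {1..n} then Some i else None) T" if "{1..n} \<subseteq> T" for n T
    using that by (auto simp: labels_assigned_def ran_def inj_on_def split: if_splits)
  have cs: "colored_surface (board_of \<alpha> \<beta> g)"
    unfolding board_of_def
    by (intro colored_surface_delete_empty_chebureks colored_surface_remove_numbers g)
  moreover have "finite (white (board_of \<alpha> \<beta> g))"
    using cs finite_black_board_of[OF g] bij_betw_finite unfolding colored_surface_def by blast
  moreover have "labels_assigned \<beta> (black_label (board_of \<alpha> \<beta> g)) (black (board_of \<alpha> \<beta> g))"
    "labels_assigned \<alpha> (white_label (board_of \<alpha> \<beta> g)) (white (board_of \<alpha> \<beta> g))"
    unfolding board_of_simps by (intro labels; auto)+
  moreover have "\<not> empty_cheburek (board_of \<alpha> \<beta> g) b w" for b w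
    by (auto simp: empty_cheburek_def cheburek_def board_of_simps split: if_splits)
  ultimately show ?thesis using finite_black_board_of[OF g] by (auto simp: board_def)
qed

text \<open>The renumbering is an isomorphism already before deletion, between the checker-boards
  with truncated labels, and it descends to the boards.\<close>

lemma surface_iso_board_of_if_double_coset:
  assumes g: "g \<in> carrier GG" and h: "h \<in> double_coset GG (K \<alpha>) g (K \<beta>)"
  shows "surface_iso (board_of \<alpha> \<beta> g) (board_of \<alpha> \<beta> h)"
proof -
  obtain p q where p: "p \<in> Sinf_stab \<alpha>" and q: "q \<in> Sinf_stab \<beta>" and hpq: "\<And>c. h c = p \<circ> g c \<circ> q"
    using h by (auto simp: mem_double_coset_GG_iff)
  have P: "p permutes {1..}" and Q: "q permutes {1..}" using p q by (auto simp: mem_Sinf_stab_iff)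
  let ?r = "inv_into UNIV q"
  have r: "?r \<in> Sinf_stab \<beta>" and R: "?r permutes {1..}"
    using inv_mem_Sinf_stab[OF q] permutes_inv[OF Q] by auto
  \<comment> \<open>A stabilizer element fixes the numbers that are kept and sends removed numbers
    to removed numbers, where both labels are \<open>None\<close>.\<close>
  have label: "truncate_label n (\<lambda>i. if i \<in> {1..} then Some i else None) (s i) =
      truncate_label n (\<lambda>i. if i \<in> {1..} then Some i else None) i" if s: "s \<in> Sinf_stab n" for s n i
  proof (cases "i \<in> {1..n}")
    case True
    then show ?thesis using s by (simp add: mem_Sinf_stab_iff)
  next
    case False
    then have "s i \<notin> {1..n}"
      using s Sinf_stab_le_iff[OF s, of i] permutes_in_image[of s "{1..}" i]
      by (auto simp: mem_Sinf_stab_iff)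
    with False show ?thesis by (simp only: truncate_label_number) simp
  qed
  have "surface_iso (remove_numbers \<alpha> \<beta> (checker_board g)) (remove_numbers \<alpha> \<beta> (checker_board h))"
    unfolding surface_iso_def
    using label[OF p] label[OF r] permutes_imp_bij[OF P] permutes_imp_bij[OF R] permutes_inverses[OF Q]
    by (intro exI[of _ ?r] exI[of _ p]) (auto simp: remove_numbers_def checker_board_def hpq)
  then show ?thesis
    unfolding board_of_def
    by (rule surface_iso_delete_empty_chebureks) (rule colored_surface_remove_numbers[OF g])
qed

section \<open>Recovering the double coset from the board\<close>

lemma bij_betw_infinite_nat_sets:
  fixes A B :: "nat set"
  assumes "infinite A" "infinite B"
  obtains f where "bij_betw f A B"
  using bij_betw_trans[OF bij_betw_inv_into[OF bij_enumerate[OF assms(1)]] bij_enumerate[OF assms(2)]]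
  by blast

text \<open>Removing finite sets from \<open>{1..}\<close> leaves infinite complements on both
  sides, and any bijection between these completes \<open>f\<close>.\<close>

lemma bij_betw_extend:
  fixes f :: "nat \<Rightarrow> nat"
  assumes f: "bij_betw f A B" and fin: "finite A" and sub: "A \<subseteq> {1..}" "B \<subseteq> {1..}"
  obtains p where "p permutes {1..}" "\<And>a. a \<in> A \<Longrightarrow> p a = f a"
proof -
  have "finite B" using f fin bij_betw_finite by blast
  then have "infinite ({1..} - A)" "infinite ({1..} - B)"
    using fin by (auto simp: infinite_Ici)
  then obtain e where e: "bij_betw e ({1..} - A) ({1..} - B)" by (rule bij_betw_infinite_nat_sets)
  define p where "p i = (if i \<in> A then f i else if i \<in> {1..} then e i else i)" for i
  have "bij_betw p A B" using f by (subst bij_betw_cong[of A p f]) (auto simp: p_def)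
  moreover have "bij_betw p ({1..} - A) ({1..} - B)"
    using e by (subst bij_betw_cong[of _ p e]) (auto simp: p_def)
  ultimately have "bij_betw p (A \<union> ({1..} - A)) (B \<union> ({1..} - B))"
    by (rule bij_betw_combine) auto
  moreover have "A \<union> ({1..} - A) = {1..}" "B \<union> ({1..} - B) = {1..}" using sub by auto
  ultimately have "p permutes {1..}"
    using sub by (intro bij_imp_permutes) (auto simp: p_def)
  then show ?thesis by (rule that) (simp add: p_def)
qed

text \<open>The isomorphism prescribes \<open>q\<close> only on the finitely many surviving black
  triangles. Any extension works: red gluing then dictates \<open>p\<close>, and the other colors
  agree with red away from the boards.\<close>

lemma double_coset_if_surface_iso_board_of:
  assumes g: "g \<in> carrier GG" and h: "h \<in> carrier GG"
    and iso: "surface_iso (board_of \<alpha> \<beta> g) (board_of \<alpha> \<beta> h)"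
  shows "h \<in> double_coset GG (K \<alpha>) g (K \<beta>)"
proof -
  let ?S = "board_of \<alpha> \<beta> g" and ?T = "board_of \<alpha> \<beta> h"
  obtain \<phi> \<psi> where b: "bij_betw \<phi> (black ?S) (black ?T)"
    and gl: "\<And>c b. b \<in> black ?S \<Longrightarrow> \<psi> (g c b) = h c (\<phi> b)"
    and lb: "\<And>b. b \<in> black ?S \<Longrightarrow> black_label ?T (\<phi> b) = black_label ?S b"
    and lw: "\<And>w. w \<in> white ?S \<Longrightarrow> white_label ?T (\<psi> w) = white_label ?S w"
    using iso unfolding surface_iso_def board_of_simps(3) by blast
  have G: "g c permutes {1..}" and H: "h c permutes {1..}" for c
    using g h by (auto simp: mem_carrier_GG_iff)
  obtain q where Q: "q permutes {1..}" and q: "\<And>i. i \<in> black ?S \<Longrightarrow> q i = \<phi> i"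
    using bij_betw_extend[OF b finite_black_board_of[OF g]]
    by (auto simp: board_of_simps(1) simp del: One_nat_def)
  \<comment> \<open>This choice makes the required identity hold for red at every number.\<close>
  define p where "p = h Red \<circ> q \<circ> inv_into UNIV (g Red)"
  have P: "p permutes {1..}"
    unfolding p_def by (intro permutes_compose permutes_inv G H Q)
  have p_Red: "p (g Red i) = h Red (q i)" for i
    by (simp add: p_def permutes_inverses[OF G])
  have p: "p w = \<psi> w" if w: "w \<in> white ?S" for w
  proof -
    have "bij_betw (g Red) (black ?S) (white ?S)"
      using board_board_of[OF g, of \<alpha> \<beta>] by (auto simp: board_def colored_surface_def board_of_simps(3))
    then obtain i where "i \<in> black ?S" "w = g Red i" using w by (auto simp: bij_betw_def)
    then show ?thesis using p_Red gl q by simp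
  qed
  have white: "g c i \<in> white ?S" if "i \<in> black ?S" for c i
    using board_board_of[OF g, of \<alpha> \<beta>] that bij_betwE
    by (fastforce simp: board_def colored_surface_def board_of_simps(3))
  \<comment> \<open>On the board this is compatibility of the isomorphism with gluing. Off the
    board, \<open>q i\<close> is off the board of \<open>h\<close> too, since \<open>q\<close> is
    injective and already covers that board; there all colors glue like red. The number
    \<open>0\<close> is fixed by everything.\<close>
  have eq: "h c (q i) = p (g c i)" for c i
  proof (cases "i \<in> black ?S")
    case True
    then show ?thesis using gl q p white by simp
  next
    case False
    show ?thesis
    proof (cases "i = 0")
      case True
      then show ?thesis
        using permutes_not_in[OF G] permutes_not_in[OF H] permutes_not_in[OF Q] permutes_not_in[OF P]
        by simp
    next
      case i: False
      have "q i \<notin> black ?T"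
      proof
        assume "q i \<in> black ?T"
        then obtain j where "j \<in> black ?S" "q i = \<phi> j" using b by (auto simp: bij_betw_def)
        with q have "q i = q j" by simp
        then have "i = j" using permutes_inj[OF Q] by (simp add: inj_eq)
        with \<open>j \<in> black ?S\<close> False show False by simp
      qed
      moreover have "0 < q i" using i permutes_in_image[OF Q, of i] by auto
      ultimately have "h c (q i) = h Red (q i)" by (auto simp: board_of_simps(1))
      moreover have "g c i = g Red i" using False i by (auto simp: board_of_simps(1))
      ultimately show ?thesis using p_Red by simp
    qed
  qed
  \<comment> \<open>Labeled triangles survive and are matched with the triangle bearing the same
    label, which is their own number.\<close>
  have "q i = i" if "i \<in> {1..\<beta>}" for i
  proof -
    have "i \<in> black ?S" using that by (auto simp: board_of_simps(1))
    then show ?thesis using lb q that by (fastforce simp: board_of_simps(4) split: if_splits)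
  qed
  \<comment> \<open>Since \<open>q\<close> maps black triangles of \<open>g\<close> to those of
    \<open>h\<close>, its inverse is the right factor.\<close>
  then have "inv_into UNIV q \<in> Sinf_stab \<beta>"
    using Q by (intro inv_mem_Sinf_stab) (simp add: mem_Sinf_stab_iff)
  moreover have "p i = i" if "i \<in> {1..\<alpha>}" for i
  proof -
    have "i \<in> white ?S" using that by (auto simp: board_of_simps(2))
    then show ?thesis using lw p that by (fastforce simp: board_of_simps(5) split: if_splits)
  qed
  then have "p \<in> Sinf_stab \<alpha>" using P by (simp add: mem_Sinf_stab_iff)
  moreover have "h c = p \<circ> g c \<circ> inv_into UNIV q" for c
    using eq permutes_inverses[OF Q] by (metis comp_apply ext)
  ultimately show ?thesis by (auto simp: mem_double_coset_GG_iff)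
qed

section \<open>Realizing every board by a group element\<close>

text \<open>Labeled triangles take their label as number; the others are numbered injectively beyond
  \<open>n\<close>.\<close>

lemma labels_assigned_numbering:
  assumes "finite T" and L: "labels_assigned n L T"
  obtains f :: "'t \<Rightarrow> nat" where "inj_on f T" "f ` T \<subseteq> {1..}" "{1..n} \<subseteq> f ` T"
    "\<And>t. t \<in> T \<Longrightarrow> (if f t \<in> {1..n} then Some (f t) else None) = L t"
proof -
  obtain e :: "'t \<Rightarrow> nat" where e: "inj_on e T"
    using finite_imp_inj_to_nat_seg[OF assms(1)] by blast
  \<comment> \<open>The injection \<open>e\<close> may take the value \<open>0\<close>;
    \<open>Suc\<close> keeps the new numbers strictly above \<open>n\<close>.\<close>
  define f where "f t = (case L t of None \<Rightarrow> Suc (n + e t) | Some k \<Rightarrow> k)" for t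
  have dom: "dom L \<subseteq> T" and inj: "inj_on L (dom L)" and ran: "ran L = {1..n}"
    using L by (auto simp: labels_assigned_def)
  have le: "k \<in> {1..n}" if "L t = Some k" for t k using ran that by (auto intro: ranI)
  have "inj_on f T"
  proof (rule inj_onI)
    fix s t assume st: "s \<in> T" "t \<in> T" "f s = f t"
    show "s = t"
    proof (cases "L s"; cases "L t")
      assume "L s = None" "L t = None"
      then show ?thesis using st e by (auto simp: f_def inj_on_def)
    next
      fix k l assume "L s = Some k" "L t = Some l"
      then show ?thesis using st inj by (auto simp: f_def intro: inj_onD)
    next
      fix k assume "L s = None" "L t = Some k"
      then show ?thesis using st le[of t k] by (auto simp: f_def)
    next
      fix k assume "L s = Some k" "L t = None"
      then show ?thesis using st le[of s k] by (auto simp: f_def)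
    qed
  qed
  moreover have "f ` T \<subseteq> {1..}" using le by (fastforce simp: f_def split: option.splits)
  moreover have "{1..n} \<subseteq> f ` T"
  proof
    fix k assume "k \<in> {1..n}"
    then obtain t where t: "L t = Some k" using ran unfolding ran_def by blast
    then have "t \<in> T" "f t = k" using dom by (auto simp: f_def)
    then show "k \<in> f ` T" by blast
  qed
  moreover have "(if f t \<in> {1..n} then Some (f t) else None) = L t" if "t \<in> T" for t
    using le by (auto simp: f_def split: option.splits)
  ultimately show ?thesis by (rule that)
qed

text \<open>The gluing of \<open>S\<close> is transported to numbers and completed by chebureks.
  Labels \<open>1\<close> to \<open>\<beta>\<close> and \<open>1\<close> to \<open>\<alpha>\<close>
  are all used up inside \<open>S\<close>, so the added chebureks are empty after
  truncation.\<close>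

lemma board_surface_iso_board_of:
  assumes S: "board \<alpha> \<beta> S"
  obtains g where "g \<in> carrier GG" "surface_iso S (board_of \<alpha> \<beta> g)"
proof -
  let ?A = "black S" and ?W = "white S"
  have fin: "finite ?A" "finite ?W" and gl: "\<And>c. bij_betw (glue S c) ?A ?W"
    and L: "labels_assigned \<beta> (black_label S) ?A" "labels_assigned \<alpha> (white_label S) ?W"
    and ne: "\<And>b w. \<not> empty_cheburek S b w"
    using S by (auto simp: board_def colored_surface_def)
  obtain \<phi> where \<phi>: "inj_on \<phi> ?A" "\<phi> ` ?A \<subseteq> {1..}" "{1..\<beta>} \<subseteq> \<phi> ` ?A"
    "\<And>b. b \<in> ?A \<Longrightarrow> (if \<phi> b \<in> {1..\<beta>} then Some (\<phi> b) else None) = black_label S b"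
    using labels_assigned_numbering[OF fin(1) L(1)] by blast
  obtain \<psi> where \<psi>: "inj_on \<psi> ?W" "\<psi> ` ?W \<subseteq> {1..}" "{1..\<alpha>} \<subseteq> \<psi> ` ?W"
    "\<And>w. w \<in> ?W \<Longrightarrow> (if \<psi> w \<in> {1..\<alpha>} then Some (\<psi> w) else None) = white_label S w"
    using labels_assigned_numbering[OF fin(2) L(2)] by blast
  have b\<phi>: "bij_betw \<phi> ?A (\<phi> ` ?A)" and b\<psi>: "bij_betw \<psi> ?W (\<psi> ` ?W)"
    using \<phi> \<psi> by (auto simp: bij_betw_def)
  have glued: "bij_betw (\<psi> \<circ> glue S c \<circ> inv_into ?A \<phi>) (\<phi> ` ?A) (\<psi> ` ?W)" for c
    using bij_betw_trans[OF bij_betw_inv_into[OF b\<phi>] bij_betw_trans[OF gl b\<psi>]]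
    by (simp add: comp_assoc)
  obtain \<theta> where \<theta>: "\<theta> permutes {1..}"
    "\<And>i. i \<in> \<phi> ` ?A \<Longrightarrow> \<theta> i = (\<psi> \<circ> glue S Red \<circ> inv_into ?A \<phi>) i"
    using bij_betw_extend[OF glued finite_imageI[OF fin(1)] \<phi>(2) \<psi>(2)] by metis
  \<comment> \<open>Outside the numbers of \<open>S\<close> all colors use the same
    \<open>\<theta>\<close>. Hence any two colors differ at finitely many numbers only, and the
    added triangles form chebureks. Since \<open>\<theta>\<close> extends the red gluing, it maps
    the complement of the black numbers onto that of the white ones, as every color
    requires.\<close>
  define g where "g c i = (if i \<in> \<phi> ` ?A then (\<psi> \<circ> glue S c \<circ> inv_into ?A \<phi>) i else \<theta> i)" for c i
  have g\<phi>: "g c (\<phi> b) = \<psi> (glue S c b)" if "b \<in> ?A" for c b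
    using that \<phi>(1) by (simp add: g_def)
  have \<theta>_im: "\<theta> ` (\<phi> ` ?A) = \<psi> ` ?W"
    using \<theta>(2) glued[of Red] by (metis (no_types, lifting) bij_betw_imp_surj_on image_cong)
  have rest: "bij_betw \<theta> ({1..} - \<phi> ` ?A) ({1..} - \<psi> ` ?W)"
    using permutes_imp_bij[OF \<theta>(1)] \<phi>(2) \<theta>_im
    by (auto simp: bij_betw_def inj_on_image_set_diff[of _ "{1..}"] intro: inj_on_subset)
  have "g c permutes {1..}" for c
  proof (rule bij_imp_permutes)
    have "bij_betw (g c) (\<phi> ` ?A) (\<psi> ` ?W)"
      using glued[of c] by (subst bij_betw_cong) (auto simp: g_def)
    moreover have "bij_betw (g c) ({1..} - \<phi> ` ?A) ({1..} - \<psi> ` ?W)"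
      using rest by (subst bij_betw_cong[of _ _ \<theta>]) (auto simp: g_def)
    ultimately have "bij_betw (g c) (\<phi> ` ?A \<union> ({1..} - \<phi> ` ?A)) (\<psi> ` ?W \<union> ({1..} - \<psi> ` ?W))"
      by (rule bij_betw_combine) auto
    moreover have "\<phi> ` ?A \<union> ({1..} - \<phi> ` ?A) = {1..}" "\<psi> ` ?W \<union> ({1..} - \<psi> ` ?W) = {1..}"
      using \<phi>(2) \<psi>(2) by auto
    ultimately show "bij_betw (g c) {1..} {1..}" by simp
    show "g c i = i" if "i \<notin> {1..}" for i
      using that \<phi>(2) permutes_not_in[OF \<theta>(1)] by (auto simp: g_def)
  qed
  moreover have "finite {i. g c i \<noteq> g d i}" for c d
    using finite_imageI[OF fin(1), of \<phi>] by (rule rev_finite_subset) (auto simp: g_def)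
  ultimately have carrier: "g \<in> carrier GG" by (auto simp: mem_carrier_GG_iff)
  have black: "black (board_of \<alpha> \<beta> g) = \<phi> ` ?A"
  proof
    show "\<phi> ` ?A \<subseteq> black (board_of \<alpha> \<beta> g)"
    proof
      fix i assume i: "i \<in> \<phi> ` ?A"
      then obtain b where b: "b \<in> ?A" "i = \<phi> b" by blast
      \<comment> \<open>A deleted triangle would come from an empty cheburek of \<open>S\<close>:
        injectivity of \<open>\<psi>\<close> turns equal values of \<open>g\<close> into one common
        white neighbor, and numbers above the bounds mean missing labels.\<close>
      have "\<not> (\<beta> < i \<and> \<alpha> < w \<and> (\<forall>c. g c i = w))" for w
      proof
        assume a: "\<beta> < i \<and> \<alpha> < w \<and> (\<forall>c. g c i = w)"
        let ?w = "glue S Red b"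
        have gw: "glue S c b \<in> ?W" for c using bij_betwE[OF gl] b by blast
        have w: "\<psi> (glue S c b) = w" for c using a b g\<phi> by metis
        then have "glue S c b = ?w" for c using gw \<psi>(1) by (metis inj_onD)
        moreover have "black_label S b = None" using a b \<phi>(4)[of b] by auto
        moreover have "white_label S ?w = None" using a w[of Red] gw \<psi>(4)[of ?w] by auto
        ultimately have "empty_cheburek S b ?w"
          using b gw by (simp add: empty_cheburek_def cheburek_def)
        with ne show False by blast
      qed
      then show "i \<in> black (board_of \<alpha> \<beta> g)"
        using i \<phi>(2) by (simp add: board_of_simps(1) subset_iff)
    qed
    show "black (board_of \<alpha> \<beta> g) \<subseteq> \<phi> ` ?A"
    proof (rule ccontr)
      assume "\<not> ?thesis"
      then obtain i where i: "i \<in> black (board_of \<alpha> \<beta> g)" "i \<notin> \<phi> ` ?A" by blast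
      then have "1 \<le> i" by (simp add: board_of_simps(1))
      have "\<theta> i \<in> {1..} - \<psi> ` ?W" using bij_betwE[OF rest] i \<open>1 \<le> i\<close> by auto
      then have "\<theta> i \<in> {1..} - {1..\<alpha>}" using \<psi>(3) by blast
      moreover have "i \<notin> {1..\<beta>}" using i \<phi>(3) by blast
      ultimately have "\<beta> < i" "\<alpha> < \<theta> i" using \<open>1 \<le> i\<close> by auto
      then have "i \<notin> black (board_of \<alpha> \<beta> g)" using i(2) by (auto simp: board_of_simps(1) g_def)
      with i show False by blast
    qed
  qed
  \<comment> \<open>The surviving white triangles are the red neighbors of the surviving black ones,
    so they need no separate analysis.\<close>
  have "bij_betw (g Red) (black (board_of \<alpha> \<beta> g)) (white (board_of \<alpha> \<beta> g))"
    using board_board_of[OF carrier, of \<alpha> \<beta>]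
    by (auto simp: board_def colored_surface_def board_of_simps(3))
  moreover have "g Red ` (\<phi> ` ?A) = \<psi> ` ?W"
    using \<theta>_im \<theta>(2) by (auto simp: g_def image_iff)
  ultimately have white: "white (board_of \<alpha> \<beta> g) = \<psi> ` ?W"
    by (simp add: black bij_betw_def)
  have "surface_iso S (board_of \<alpha> \<beta> g)"
    unfolding surface_iso_def black white board_of_simps(3-5)
    using b\<phi> b\<psi> g\<phi> \<phi>(4) \<psi>(4) by (intro exI[of _ \<phi>] exI[of _ \<psi>]) simp
  with carrier show ?thesis by (rule that)
qed

section \<open>The one-to-one correspondence\<close>

text \<open>The second conjunct determines the map on every double coset, since double cosets are
  nonempty; this expresses that the bijection is canonical.\<close>

theorem proposition2p3:
  fixes \<alpha> \<beta> :: nat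
  shows "\<exists>\<Phi> :: (color \<Rightarrow> nat \<Rightarrow> nat) set \<Rightarrow> (nat, nat) surface set.
    bij_betw \<Phi> (double_cosets GG (K \<alpha>) (K \<beta>)) (boards \<alpha> \<beta>) \<and>
    (\<forall>D \<in> double_cosets GG (K \<alpha>) (K \<beta>). \<forall>g \<in> D.
       board \<alpha> \<beta> (board_of \<alpha> \<beta> g) \<and>
       \<Phi> D = board_iso_rel \<alpha> \<beta> `` {board_of \<alpha> \<beta> g})"
proof -
  interpret G: group GG by (rule group_GG)
  let ?DC = "double_cosets GG (K \<alpha>) (K \<beta>)" and ?D = "\<lambda>g. double_coset GG (K \<alpha>) g (K \<beta>)"
  let ?R = "board_iso_rel \<alpha> \<beta>" and ?b = "board_of \<alpha> \<beta>"
  note sub = subgroup_K[of \<alpha>] subgroup_K[of \<beta>]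
  \<comment> \<open>The representative is arbitrary; the fact \<open>\<Phi>\<close> below shows that
    every member of \<open>D\<close> gives the same class.\<close>
  define \<Phi> where "\<Phi> D = ?R `` {?b (SOME g. g \<in> D)}" for D
  have mem: "g \<in> carrier GG \<and> D = ?D g" if D: "D \<in> ?DC" and g: "g \<in> D" for D g
  proof -
    obtain x where x: "x \<in> carrier GG" "D = ?D x" using D by (auto simp: double_cosets_def)
    have "g \<in> carrier GG"
      using g x subgroup.mem_carrier[OF sub(1)] subgroup.mem_carrier[OF sub(2)]
      by (auto simp: G.mem_double_coset_iff)
    moreover have "D = ?D g" using G.double_coset_eqI[OF sub x(1)] g x(2) by simp
    ultimately show ?thesis by blast
  qed
  \<comment> \<open>One direction of this equivalence makes the map independent of representatives,
    the other makes it injective.\<close>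
  have rel_iff: "(?b g, ?b h) \<in> ?R \<longleftrightarrow> ?D g = ?D h" if g: "g \<in> carrier GG" and h: "h \<in> carrier GG" for g h
  proof -
    have "(?b g, ?b h) \<in> ?R \<longleftrightarrow> h \<in> ?D g"
      using board_board_of g h double_coset_if_surface_iso_board_of[OF g h]
        surface_iso_board_of_if_double_coset[OF g]
      by (auto simp: board_iso_rel_def)
    then show ?thesis
      using G.double_coset_eqI[OF sub g, of h] G.mem_double_coset_self[OF sub h] by auto
  qed
  have \<Phi>: "\<Phi> D = ?R `` {?b g}" if D: "D \<in> ?DC" and g: "g \<in> D" for D g
  proof -
    have s: "(SOME g. g \<in> D) \<in> D" using g by (rule someI[of "\<lambda>g. g \<in> D"])
    have "(?b (SOME g. g \<in> D), ?b g) \<in> ?R"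
      using mem[OF D s] mem[OF D g] rel_iff by auto
    then show ?thesis unfolding \<Phi>_def by (rule equiv_class_eq[OF equiv_board_iso_rel])
  qed
  have DC: "?D g \<in> ?DC" "g \<in> ?D g" if "g \<in> carrier GG" for g
    using that G.mem_double_coset_self[OF sub] by (auto simp: double_cosets_def)
  have "inj_on \<Phi> ?DC"
  proof (rule inj_onI)
    fix D E assume DE: "D \<in> ?DC" "E \<in> ?DC" and eq: "\<Phi> D = \<Phi> E"
    obtain g h where g: "g \<in> carrier GG" "D = ?D g" and h: "h \<in> carrier GG" "E = ?D h"
      using DE by (auto simp: double_cosets_def)
    have "?R `` {?b g} = ?R `` {?b h}"
      using eq \<Phi>[OF DC[OF g(1)]] \<Phi>[OF DC[OF h(1)]] g(2) h(2) by simp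
    then have "(?b g, ?b h) \<in> ?R"
      using equiv_board_iso_rel board_board_of[OF h(1)] by (metis eq_equiv_class mem_Collect_eq)
    with rel_iff[OF g(1) h(1)] g(2) h(2) show "D = E" by simp
  qed
  moreover have "\<Phi> ` ?DC = boards \<alpha> \<beta>"
  proof
    show "\<Phi> ` ?DC \<subseteq> boards \<alpha> \<beta>"
    proof (rule image_subsetI)
      fix D assume D: "D \<in> ?DC"
      then obtain g where g: "g \<in> carrier GG" "D = ?D g" by (auto simp: double_cosets_def)
      then have "\<Phi> D = ?R `` {?b g}" using \<Phi>[OF D] DC(2) by simp
      moreover have "?b g \<in> {S. board \<alpha> \<beta> S}" using board_board_of[OF g(1)] by simp
      ultimately show "\<Phi> D \<in> boards \<alpha> \<beta>" by (simp only: boards_def quotientI)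
    qed
    show "boards \<alpha> \<beta> \<subseteq> \<Phi> ` ?DC"
    proof
      fix C assume "C \<in> boards \<alpha> \<beta>"
      then obtain S where S: "board \<alpha> \<beta> S" "C = ?R `` {S}"
        by (auto simp: boards_def elim!: quotientE)
      obtain g where g: "g \<in> carrier GG" "surface_iso S (?b g)" by (rule board_surface_iso_board_of[OF S(1)])
      then have "(S, ?b g) \<in> ?R" using S(1) board_board_of by (auto simp: board_iso_rel_def)
      then have "C = ?R `` {?b g}" using S(2) equiv_class_eq[OF equiv_board_iso_rel] by blast
      then show "C \<in> \<Phi> ` ?DC" using \<Phi>[OF DC[OF g(1)]] DC[OF g(1)] by blast
    qed
  qed
  ultimately have "bij_betw \<Phi> ?DC (boards \<alpha> \<beta>)" by (simp add: bij_betw_def)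
  moreover have "board \<alpha> \<beta> (?b g)" if "D \<in> ?DC" "g \<in> D" for D g
    using mem[OF that] board_board_of by blast
  ultimately show ?thesis using \<Phi> by blast
qed

end
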